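(* Let $n \ge 1$ and $m \ge 1$ be integers, and let $A_1,\dots,A_m, B_1,\dots,B_m \subseteq [n]=\{1,\dots,n\}$ be such that $\mathcal{P}=\{(A_i,B_i)\mid i\in[m]\}$ is a skew Bollobás system. Then $$\sum_{i=1}^m \frac{1}{(1+|A_i|+|B_i|)\binom{|A_i|+|B_i|}{|A_i|}} \le 1.$$
   Context: A family of pairs of sets $\mathcal{P}=\{(A_i,B_i)\mid i\in[m]\}$ is called a skew Bollobás system if (1) $A_i\cap B_i=\emptyset$ for every $i\in[m]$, and (2) $A_i\cap B_j\neq\emptyset$ whenever $i<j$. *)

theory Defs
  imports Complex_Main
begin

text \<open>The family is indexed by \<open>{1..m}\<close>: the skew condition refers to the order of the
  indices, so the pairs are given as two sequences. Values at indices outside \<open>{1..m}\<close>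
  play no role.\<close>

definition skew_bollobas_system :: "nat \<Rightarrow> (nat \<Rightarrow> 'a set) \<Rightarrow> (nat \<Rightarrow> 'a set) \<Rightarrow> bool" where
  "skew_bollobas_system m A B \<longleftrightarrow>
     (\<forall>i\<in>{1..m}. A i \<inter> B i = {}) \<and>
     (\<forall>i\<in>{1..m}. \<forall>j\<in>{1..m}. i < j \<longrightarrow> A i \<inter> B j \<noteq> {})"

end

theory Submission
  imports Defs
begin

text \<open>Choose a random subset \<open>S\<close> of the ground set \<open>U\<close> by drawing its size uniformly from
  \<open>{0..card U}\<close> and then \<open>S\<close> uniformly among the sets of that size. For disjoint \<open>A\<close> and \<open>B\<close>
  of sizes \<open>a\<close> and \<open>b\<close>, the event \<open>A \<subseteq> S \<subseteq> U - B\<close> has probability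
  \<open>1 / ((1 + a + b) * (a + b choose a))\<close>. For two pairs of a skew Bollobas system these events
  are incompatible, because a point of \<open>A\<^sub>i \<inter> B\<^sub>j\<close> would have to lie both in and outside \<open>S\<close>.\<close>

text \<open>The Beta integral \<open>\<integral> p\<^sup>a (1 - p)\<^sup>b dp\<close> over \<open>[0, 1]\<close>.\<close>

definition beta_weight :: "nat \<Rightarrow> nat \<Rightarrow> real" where
  "beta_weight a b = fact a * fact b / fact (Suc (a + b))"

lemma beta_weight_binomial:
  "beta_weight a b = 1 / ((1 + real a + real b) * real ((a + b) choose a))"
  by (simp add: beta_weight_def binomial_fact field_simps)

lemma beta_weight_nonneg: "0 \<le> beta_weight a b"
  by (simp add: beta_weight_def)

text \<open>Under the integral this is \<open>p + (1 - p) = 1\<close>, multiplied by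
  \<open>p^a (1 - p)^b\<close>.\<close>

lemma beta_weight_split: "beta_weight (Suc a) b + beta_weight a (Suc b) = beta_weight a b"
proof -
  have "beta_weight (Suc a) b + beta_weight a (Suc b)
      = real (a + b + 2) * (fact a * fact b) / fact (Suc (Suc (a + b)))"
    by (simp add: beta_weight_def add_divide_distrib [symmetric] algebra_simps)
  also have "\<dots> = real (a + b + 2) * (fact a * fact b) / (real (a + b + 2) * fact (Suc (a + b)))"
    by (subst fact_Suc) (simp add: add.commute)
  also have "\<dots> = beta_weight a b"
    unfolding beta_weight_def by (rule mult_divide_mult_cancel_left) simp
  finally show ?thesis .
qed

text \<open>Expands one factor \<open>p + (1 - p)\<close> per element of \<open>C\<close>: a point
  in \<open>S\<close> raises the first exponent, a point outside raises the second. The offsets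
  \<open>a\<close> and \<open>b\<close> must vary in the induction to absorb these shifts.\<close>

lemma sum_beta_weight_Pow:
  assumes "finite C"
  shows "(\<Sum>S\<in>Pow C. beta_weight (a + card S) (b + card (C - S))) = beta_weight a b"
  using assms
proof (induction C arbitrary: a b)
  case empty
  then show ?case by simp
next
  case (insert x C)
  have fin: "finite S" if "S \<in> Pow C" for S
    using that insert.hyps(1) finite_subset by blast
  have inj: "inj_on (insert x) (Pow C)"
    using insert.hyps(2) by (auto simp: inj_on_def)
  have out: "card (insert x C - S) = Suc (card (C - S))" if "S \<in> Pow C" for S
  proof -
    have "insert x C - S = insert x (C - S)"
      using that insert.hyps(2) by auto
    then show ?thesis
      using insert.hyps by simp
  qed
  have into: "card (insert x S) = Suc (card S)" "C - insert x S = C - S"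
    if "S \<in> Pow C" for S
  proof -
    have "x \<notin> S"
      using that insert.hyps(2) by auto
    then show "card (insert x S) = Suc (card S)" "C - insert x S = C - S"
      using fin [OF that] insert.hyps(2) by auto
  qed
  have "(\<Sum>S\<in>Pow (insert x C). beta_weight (a + card S) (b + card (insert x C - S)))
      = (\<Sum>S\<in>Pow C. beta_weight (a + card S) (b + card (insert x C - S)))
        + (\<Sum>S\<in>insert x ` Pow C. beta_weight (a + card S) (b + card (insert x C - S)))"
    unfolding Pow_insert using insert.hyps by (intro sum.union_disjoint) auto
  also have "\<dots> = (\<Sum>S\<in>Pow C. beta_weight (a + card S) (Suc b + card (C - S)))
        + (\<Sum>S\<in>Pow C. beta_weight (Suc a + card S) (b + card (C - S)))"
    by (simp add: sum.reindex [OF inj] out into cong: sum.cong_simp)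
  also have "\<dots> = beta_weight a b"
    unfolding insert.IH using beta_weight_split [of a b] by linarith
  finally show ?case .
qed

text \<open>Only the points of \<open>C = U - (A \<union> B)\<close> are free. The forced points of
  \<open>A\<close> and \<open>B\<close> supply the offsets \<open>card A\<close> and
  \<open>card B\<close>.\<close>

lemma sum_beta_weight_interval:
  assumes "finite U" "A \<subseteq> U" "B \<subseteq> U" "A \<inter> B = {}"
  shows "(\<Sum>S\<in>{A..U - B}. beta_weight (card S) (card (U - S))) = beta_weight (card A) (card B)"
proof -
  define C where "C = U - (A \<union> B)"
  have fin: "finite A" "finite B" "finite C"
    using assms finite_subset by (auto simp: C_def)
  have interval: "{A..U - B} = (\<union>) A ` Pow C"
  proof (intro subset_antisym subsetI)
    fix S assume "S \<in> {A..U - B}"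
    then have "S = A \<union> (S - A)" "S - A \<in> Pow C"
      by (auto simp: C_def)
    then show "S \<in> (\<union>) A ` Pow C" by blast
  qed (use assms in \<open>auto simp: C_def\<close>)
  have inj: "inj_on ((\<union>) A) (Pow C)"
    by (auto simp: inj_on_def C_def)
  have cards: "card (A \<union> S) = card A + card S" "card (U - (A \<union> S)) = card B + card (C - S)"
    if "S \<in> Pow C" for S
  proof -
    show "card (A \<union> S) = card A + card S"
      using that fin finite_subset [of S C] by (intro card_Un_disjoint) (auto simp: C_def)
    have "U - (A \<union> S) = B \<union> (C - S)"
      using that assms by (auto simp: C_def)
    then show "card (U - (A \<union> S)) = card B + card (C - S)"
      using fin by (simp, intro card_Un_disjoint) (auto simp: C_def)
  qed
  show ?thesis
    using sum_beta_weight_Pow [OF fin(3), of "card A" "card B"]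
    by (simp add: interval sum.reindex [OF inj] cards cong: sum.cong_simp)
qed

lemma skew_bollobas_intervals_disjoint:
  assumes "skew_bollobas_system m A B" "i \<in> {1..m}" "j \<in> {1..m}" "i \<noteq> j"
  shows "{A i..U - B i} \<inter> {A j..U - B j} = {}"
proof -
  \<comment> \<open>The order of \<open>i\<close> and \<open>j\<close> decides which disjunct holds;
    either one separates the intervals.\<close>
  have "A i \<inter> B j \<noteq> {} \<or> A j \<inter> B i \<noteq> {}"
    using assms unfolding skew_bollobas_system_def by (metis nat_neq_iff)
  then show ?thesis by fastforce
qed

theorem theorem1p5:
  fixes n m :: nat
    and A B :: "nat \<Rightarrow> nat set"
  assumes "n \<ge> 1" and "m \<ge> 1"
    and "\<And>i. i \<in> {1..m} \<Longrightarrow> A i \<subseteq> {1..n}"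
    and "\<And>i. i \<in> {1..m} \<Longrightarrow> B i \<subseteq> {1..n}"
    and "skew_bollobas_system m A B"
  shows "(\<Sum>i = 1..m. 1 / ((1 + real (card (A i)) + real (card (B i)))
            * real ((card (A i) + card (B i)) choose card (A i)))) \<le> 1"
proof -
  let ?U = "{1..n}" and ?I = "\<lambda>i. {A i..{1..n} - B i}"
  \<comment> \<open>For \<open>S \<subseteq> ?U\<close> this is
    \<open>1 / ((n + 1) * (n choose card S))\<close>, the probability of drawing
    \<open>S\<close>.\<close>
  let ?w = "\<lambda>S. beta_weight (card S) (card (?U - S))"
  have sub: "?I i \<subseteq> Pow ?U" for i
    by fastforce
  have fin: "finite (?I i)" for i
    by (rule finite_subset [OF sub]) simp
  have disj: "A i \<inter> B i = {}" if "i \<in> {1..m}" for i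
    using assms(5) that by (auto simp: skew_bollobas_system_def)
  have "(\<Sum>i = 1..m. 1 / ((1 + real (card (A i)) + real (card (B i)))
            * real ((card (A i) + card (B i)) choose card (A i))))
      = (\<Sum>i = 1..m. \<Sum>S\<in>?I i. ?w S)"
    unfolding beta_weight_binomial [symmetric]
    by (intro sum.cong refl sum_beta_weight_interval [symmetric] assms(3,4) disj) simp_all
  also have "\<dots> = (\<Sum>S\<in>(\<Union>i\<in>{1..m}. ?I i). ?w S)"
    using fin skew_bollobas_intervals_disjoint [OF assms(5)]
    by (intro sum.UNION_disjoint [symmetric]) auto
  also have "\<dots> \<le> (\<Sum>S\<in>Pow ?U. ?w S)"
    using sub by (intro sum_mono2) (auto simp: beta_weight_nonneg)
  \<comment> \<open>With zero offsets the total mass is \<open>beta_weight 0 0\<close>, the integral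
    of 1.\<close>
  also have "\<dots> = 1"
    using sum_beta_weight_Pow [of ?U 0 0] by (simp add: beta_weight_def)
  finally show ?thesis .
qed

end
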